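(* The minimal faithful permutation degree of the Coxeter group of type $F_4$ is $24$, that is, $\mu(W(F_4))=24$.
   Context: For a finite group $G$, $\mu(G)$ denotes the minimal faithful permutation degree of $G$: the least non-negative integer $m$ such that $G$ embeds in the symmetric group $\mathrm{Sym}(m)$. $W(F_4)$ denotes the finite irreducible Coxeter group of type $F_4$ (Coxeter diagram a path on $4$ vertices with consecutive edge labels $3,4,3$), of order $1152$. *)

theory Defs
  imports "HOL-Algebra.Sym_Groups"
begin

text \<open>
  The Coxeter group with generating set \<open>S\<close> and Coxeter matrix \<open>m\<close> is the group with presentation
  \<open>\<langle>S | (s t)^(m s t) = 1 for s, t in S\<rangle>\<close>, where \<open>m s s = 1\<close>; the entry \<open>0\<close> encodes
  \<open>m s t = \<infinity>\<close>, i.e. no relation between \<open>s\<close> and \<open>t\<close>.  Because the relations \<open>s s = 1\<close> make each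
  generator its own inverse, formal inverses are not needed, and the group is the free monoid of
  words over \<open>S\<close> modulo the congruence generated by the relations.
\<close>

inductive coxeter_eq :: "'a set \<Rightarrow> ('a \<Rightarrow> 'a \<Rightarrow> nat) \<Rightarrow> 'a list \<Rightarrow> 'a list \<Rightarrow> bool"
  for S :: "'a set" and m :: "'a \<Rightarrow> 'a \<Rightarrow> nat" where
  relator: "s \<in> S \<Longrightarrow> t \<in> S \<Longrightarrow> coxeter_eq S m (concat (replicate (m s t) [s, t])) []"
| refl: "u \<in> lists S \<Longrightarrow> coxeter_eq S m u u"
| sym: "coxeter_eq S m u v \<Longrightarrow> coxeter_eq S m v u"
| trans: "coxeter_eq S m u v \<Longrightarrow> coxeter_eq S m v w \<Longrightarrow> coxeter_eq S m u w"
| append: "coxeter_eq S m u v \<Longrightarrow> coxeter_eq S m u' v' \<Longrightarrow> coxeter_eq S m (u @ u') (v @ v')"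

definition coxeter_rel :: "'a set \<Rightarrow> ('a \<Rightarrow> 'a \<Rightarrow> nat) \<Rightarrow> ('a list \<times> 'a list) set" where
  "coxeter_rel S m = {(u, v). coxeter_eq S m u v}"

definition coxeter_group :: "'a set \<Rightarrow> ('a \<Rightarrow> 'a \<Rightarrow> nat) \<Rightarrow> 'a list set monoid" where
  "coxeter_group S m =
     \<lparr>carrier = lists S // coxeter_rel S m,
      mult = (\<lambda>A B. \<Union>u\<in>A. \<Union>v\<in>B. coxeter_rel S m `` {u @ v}),
      one = coxeter_rel S m `` {[]}\<rparr>"

lemma coxeter_eq_lists:
  assumes "coxeter_eq S m u v"
  shows "u \<in> lists S \<and> v \<in> lists S"
  using assms by induction (auto split: if_splits)

lemma equiv_coxeter_rel: "equiv (lists S) (coxeter_rel S m)"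
proof (rule equivI)
  show "coxeter_rel S m \<subseteq> lists S \<times> lists S"
    unfolding coxeter_rel_def using coxeter_eq_lists by fastforce
  show "refl_on (lists S) (coxeter_rel S m)"
    unfolding coxeter_rel_def by (auto intro!: refl_onI coxeter_eq.refl)
  show "sym (coxeter_rel S m)"
    unfolding coxeter_rel_def by (rule symI) (simp add: coxeter_eq.sym)
  show "trans (coxeter_rel S m)"
    unfolding coxeter_rel_def by (rule transI) (simp, rule coxeter_eq.trans)
qed

lemma coxeter_class_eq_iff:
  assumes "u \<in> lists S" "v \<in> lists S"
  shows "coxeter_rel S m `` {u} = coxeter_rel S m `` {v} \<longleftrightarrow> coxeter_eq S m u v"
  using eq_equiv_class_iff[OF equiv_coxeter_rel assms, of m] by (simp add: coxeter_rel_def)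

lemma coxeter_group_mult:
  assumes "u \<in> lists S" "v \<in> lists S"
  shows "(coxeter_rel S m `` {u}) \<otimes>\<^bsub>coxeter_group S m\<^esub> (coxeter_rel S m `` {v})
           = coxeter_rel S m `` {u @ v}"
proof -
  have "congruent2 (coxeter_rel S m) (coxeter_rel S m) (\<lambda>u v. coxeter_rel S m `` {u @ v})"
  proof (rule congruent2I')
    fix u u' v v'
    assume "(u, u') \<in> coxeter_rel S m" "(v, v') \<in> coxeter_rel S m"
    then have "(u @ v, u' @ v') \<in> coxeter_rel S m"
      unfolding coxeter_rel_def by (simp add: coxeter_eq.append)
    then show "coxeter_rel S m `` {u @ v} = coxeter_rel S m `` {u' @ v'}"
      by (rule equiv_class_eq[OF equiv_coxeter_rel])
  qed
  from UN_equiv_class2[OF equiv_coxeter_rel equiv_coxeter_rel this assms]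
  show ?thesis
    unfolding coxeter_group_def by simp
qed

lemma coxeter_eq_rev_cancel:
  assumes diag: "\<And>s. s \<in> S \<Longrightarrow> m s s = 1" and "u \<in> lists S"
  shows "coxeter_eq S m (rev u @ u) []"
  using assms(2)
proof (induction u)
  case Nil
  then show ?case by (simp add: coxeter_eq.refl)
next
  case (Cons s u)
  have s: "s \<in> S" and u: "u \<in> lists S" using Cons.hyps by auto
  have "coxeter_eq S m [s, s] []"
    using coxeter_eq.relator[OF s s, of m] diag[OF s] by simp
  then have "coxeter_eq S m ([s, s] @ u) ([] @ u)"
    using u by (rule coxeter_eq.append[OF _ coxeter_eq.refl])
  then have "coxeter_eq S m (rev u @ [s, s] @ u) (rev u @ [] @ u)"
    using u by (intro coxeter_eq.append[of S m "rev u"] coxeter_eq.refl[of "rev u"]) auto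
  then have "coxeter_eq S m (rev u @ [s, s] @ u) []"
    using Cons.IH coxeter_eq.trans[of S m _ "rev u @ u"] by simp
  then show ?case by simp
qed

lemma group_coxeter_group:
  assumes diag: "\<And>s. s \<in> S \<Longrightarrow> m s s = 1"
  shows "group (coxeter_group S m)"
proof (rule groupI)
  let ?G = "coxeter_group S m" and ?c = "\<lambda>u. coxeter_rel S m `` {u}"
  have carr: "x \<in> carrier ?G \<longleftrightarrow> (\<exists>u\<in>lists S. x = ?c u)" for x
    by (auto simp: coxeter_group_def quotient_def)
  have one: "\<one>\<^bsub>?G\<^esub> = ?c []" by (simp add: coxeter_group_def)
  show "\<one>\<^bsub>?G\<^esub> \<in> carrier ?G" unfolding carr one by (rule bexI[of _ "[]"]) simp_all
  fix x assume "x \<in> carrier ?G"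
  then obtain u where u: "u \<in> lists S" "x = ?c u" unfolding carr by blast
  show "\<one>\<^bsub>?G\<^esub> \<otimes>\<^bsub>?G\<^esub> x = x"
    using coxeter_group_mult[OF lists.Nil u(1), of m] by (simp add: one u(2))
  have r: "rev u \<in> lists S" using u by auto
  have "?c (rev u) \<otimes>\<^bsub>?G\<^esub> x = \<one>\<^bsub>?G\<^esub>"
  proof -
    have "coxeter_eq S m (rev u @ u) []"
      by (rule coxeter_eq_rev_cancel) (use diag u(1) in auto)
    moreover have "rev u @ u \<in> lists S" "[] \<in> lists S"
      using u(1) by auto
    ultimately show ?thesis
      unfolding one u(2) coxeter_group_mult[OF r u(1)] by (simp add: coxeter_class_eq_iff)
  qed
  then show "\<exists>y\<in>carrier ?G. y \<otimes>\<^bsub>?G\<^esub> x = \<one>\<^bsub>?G\<^esub>"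
    using r by (intro bexI[of _ "?c (rev u)"]) (auto simp: carr)
  fix y assume "y \<in> carrier ?G"
  then obtain v where v: "v \<in> lists S" "y = ?c v" unfolding carr by blast
  have uv: "u @ v \<in> lists S" using u v by auto
  show "x \<otimes>\<^bsub>?G\<^esub> y \<in> carrier ?G"
    unfolding u(2) v(2) coxeter_group_mult[OF u(1) v(1)] carr by (rule bexI[of _ "u @ v", OF HOL.refl uv])
  fix z assume "z \<in> carrier ?G"
  then obtain w where w: "w \<in> lists S" "z = ?c w" unfolding carr by blast
  have vw: "v @ w \<in> lists S" using v w by auto
  show "x \<otimes>\<^bsub>?G\<^esub> y \<otimes>\<^bsub>?G\<^esub> z = x \<otimes>\<^bsub>?G\<^esub> (y \<otimes>\<^bsub>?G\<^esub> z)"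
    unfolding u(2) v(2) w(2) coxeter_group_mult[OF u(1) v(1)] coxeter_group_mult[OF v(1) w(1)]
      coxeter_group_mult[OF uv w(1)] coxeter_group_mult[OF u(1) vw] by simp
qed

text \<open>The diagram of type \<open>F\<^sub>4\<close> is the path \<open>1 - 2 - 3 - 4\<close> with edge labels \<open>3, 4, 3\<close>.\<close>

definition F4_matrix :: "nat \<Rightarrow> nat \<Rightarrow> nat" where
  "F4_matrix i j =
     (if i = j then 1
      else if {i, j} = {1, 2} then 3
      else if {i, j} = {2, 3} then 4
      else if {i, j} = {3, 4} then 3
      else 2)"

definition W_F4 :: "nat list set monoid" where
  "W_F4 = coxeter_group {1..4} F4_matrix"

lemma group_W_F4: "group W_F4"
proof -
  have "F4_matrix s s = 1" for s
    unfolding F4_matrix_def if_P[OF HOL.refl] by (rule HOL.refl)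
  then show ?thesis
    unfolding W_F4_def by (rule group_coxeter_group)
qed

text \<open>
  Meaningful for finite groups, which embed in some \<open>sym_group m\<close> by Cayley's theorem; if no \<open>m\<close>
  qualifies, \<open>LEAST\<close> is unspecified.
\<close>

definition min_perm_degree :: "('a, 'b) monoid_scheme \<Rightarrow> nat" where
  "min_perm_degree G = (LEAST m. mon G (sym_group m) \<noteq> {})"

end

theory Submission
  imports Defs "HOL-Library.Product_Plus"
begin

text \<open>
  Upper bound.  The group acts on \<open>\<int>\<^sup>4\<close> by the reflections in the simple roots and permutes the
  24 long roots.  An element fixing all long roots acts trivially, because the long roots span
  the space over the rationals.  What remains is that an element of the abstractly presented group
  acting trivially is trivial.  This is Tits' theorem on the geometric representation, proved here
  for any action with simple roots whose rank two behaviour is the expected one: a shortest word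
  \<open>w\<close> either sends the simple root \<open>\<alpha> s\<close> to a nonnegative combination of simple roots or can be
  rewritten, at the same length, to end in \<open>s\<close> (\<open>reduced_positive_or_descent\<close>), so a nonempty
  shortest word \<open>v @ [s]\<close> sends \<open>\<alpha> s\<close> to a negative root.

  Lower bound.  View \<open>\<real>\<^sup>4\<close> as the quaternions.  The Coxeter group contains multiplication by
  \<open>\<plusminus>1, \<plusminus>i, \<plusminus>j, \<plusminus>k\<close> from one side, a quaternion group \<open>K\<close> of order 8, and multiplication \<open>a\<close> by a
  unit of order 3 from the other side; these commute.  Let \<open>z = -1\<close>, a central element.  Suppose
  that the group acts faithfully on \<open>m\<close> points, and let \<open>N\<close> be the set of points moved both by
  \<open>z\<close> and by \<open>a\<close>.  Since \<open>a\<close> and \<open>z\<close> commute with \<open>a\<close> and \<open>K\<close>, both \<open>K\<close> and \<open>\<langle>a\<rangle>\<close> act on \<open>N\<close>.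
  Every nontrivial element of \<open>K\<close> has \<open>z\<close> as a power and every nontrivial element of \<open>\<langle>a\<rangle>\<close>
  has \<open>a\<close> as a power, so none of them fixes a point of \<open>N\<close>: both actions are semiregular, and
  \<open>card N\<close> is divisible by 8 and by 3, hence by 24.  Finally \<open>N\<close> is nonempty: otherwise \<open>a\<close>,
  and with it the whole normal closure of \<open>a\<close>, would fix every point moved by \<open>z\<close>; but \<open>z\<close> itself
  lies in that normal closure, being the square of a commutator of \<open>a\<close>.  So \<open>m \<ge> 24\<close>
  (\<open>card_mult_card_le_degree\<close>).
\<close>

section \<open>Words modulo the Coxeter relations\<close>

lemma coxeter_eq_append_left:
  assumes "coxeter_eq S m u v" "x \<in> lists S"
  shows "coxeter_eq S m (x @ u) (x @ v)"
  using assms by (intro coxeter_eq.append coxeter_eq.refl)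

lemma coxeter_eq_append_right:
  assumes "coxeter_eq S m u v" "x \<in> lists S"
  shows "coxeter_eq S m (u @ x) (v @ x)"
  using assms by (intro coxeter_eq.append coxeter_eq.refl)

definition reduced :: "'a set \<Rightarrow> ('a \<Rightarrow> 'a \<Rightarrow> nat) \<Rightarrow> 'a list \<Rightarrow> bool" where
  "reduced S m u \<longleftrightarrow> u \<in> lists S \<and> (\<forall>v. coxeter_eq S m u v \<longrightarrow> length u \<le> length v)"

lemma reduced_factor:
  assumes "reduced S m (x @ y @ z)"
  shows "reduced S m y"
  unfolding reduced_def
proof (intro conjI allI impI)
  have l: "x \<in> lists S" "y \<in> lists S" "z \<in> lists S"
    using assms by (auto simp: reduced_def)
  show "y \<in> lists S" by fact
  fix v assume "coxeter_eq S m y v"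
  then have "coxeter_eq S m (x @ y @ z) (x @ v @ z)"
    using l by (intro coxeter_eq_append_left coxeter_eq_append_right)
  then have "length (x @ y @ z) \<le> length (x @ v @ z)"
    using assms unfolding reduced_def by blast
  then show "length y \<le> length v" by simp
qed

lemma reduced_equiv:
  assumes "reduced S m u" "coxeter_eq S m u v" "length v \<le> length u"
  shows "reduced S m v"
  using assms coxeter_eq_lists[OF assms(2)] coxeter_eq.trans[OF assms(2)]
  unfolding reduced_def by (meson order_trans)

lemma ex_reduced:
  assumes "u \<in> lists S"
  shows "\<exists>v. coxeter_eq S m u v \<and> reduced S m v"
proof -
  obtain v where v: "coxeter_eq S m u v" "\<And>w. coxeter_eq S m u w \<Longrightarrow> length v \<le> length w"
    using ex_has_least_nat[of "coxeter_eq S m u" u length] coxeter_eq.refl[OF assms] by blast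
  then show ?thesis
    using coxeter_eq.trans[OF v(1)] coxeter_eq_lists[OF v(1)] unfolding reduced_def by blast
qed

text \<open>
  The alternating word of length \<open>k\<close> is indexed from its right end, so that it ends in \<open>t\<close>: the last
  letter is the one that acts first on a root.
\<close>

primrec alt_word :: "'a \<Rightarrow> 'a \<Rightarrow> nat \<Rightarrow> 'a list" where
  "alt_word s t 0 = []"
| "alt_word s t (Suc k) = alt_word t s k @ [t]"

lemma length_alt_word [simp]: "length (alt_word s t k) = k"
  by (induction k arbitrary: s t) auto

lemma alt_word_lists: "s \<in> S \<Longrightarrow> t \<in> S \<Longrightarrow> alt_word s t k \<in> lists S"
  by (induction k arbitrary: s t) auto

lemma alt_word_add:
  "alt_word s t (k + n) = (if even n then alt_word s t k else alt_word t s k) @ alt_word s t n"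
  by (induction n arbitrary: s t) auto

lemma rev_alt_word: "rev (alt_word s t k) = (if even k then alt_word t s k else alt_word s t k)"
proof (induction k arbitrary: s t)
  case (Suc k)
  have cons: "alt_word s t (Suc k) = (if even k then t else s) # alt_word s t k" for s t :: 'a
    using alt_word_add[of s t 1 k] by simp
  have "rev (alt_word s t (Suc k)) = t # rev (alt_word t s k)" by simp
  also have "\<dots> = (if even (Suc k) then alt_word t s (Suc k) else alt_word s t (Suc k))"
    unfolding cons using Suc[of t s] by simp
  finally show ?case .
qed simp

lemma concat_replicate_alt_word: "concat (replicate k [s, t]) = alt_word s t (2 * k)"
proof (induction k)
  case (Suc k)
  have "concat (replicate (Suc k) [s, t]) = concat (replicate k [s, t]) @ [s, t]"
    by (metis append_Nil2 concat.simps(1,2) concat_append replicate_Suc replicate_append_same)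
  then show ?case using Suc by simp
qed simp

text \<open>
  The relator \<open>(s t)\<^bsup>m s t\<^esup>\<close> is an alternating word of length \<open>2 * m s t\<close>.  Its right half is therefore
  inverse to its left half, and the inverse of the left half is its reversal, the alternating
  word ending in the other letter.  For \<open>m s t = 0\<close> both sides are empty.
\<close>

lemma braid_relation:
  assumes "s \<in> S" "t \<in> S" and diag: "\<And>s. s \<in> S \<Longrightarrow> m s s = 1"
  shows "coxeter_eq S m (alt_word s t (m s t)) (alt_word t s (m s t))"
proof -
  let ?Y = "alt_word s t (m s t)"
  let ?X = "if even (m s t) then ?Y else alt_word t s (m s t)"
  have l: "?X \<in> lists S" "?Y \<in> lists S" "rev ?X \<in> lists S"
    using assms by (auto simp: alt_word_lists rev_alt_word)
  have "coxeter_eq S m (alt_word s t (m s t + m s t)) []"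
    using coxeter_eq.relator[OF assms(1,2), of m]
    by (simp only: concat_replicate_alt_word mult_2)
  then have "coxeter_eq S m (?X @ ?Y) []"
    by (simp only: alt_word_add)
  then have "coxeter_eq S m (rev ?X @ ?X @ ?Y) (rev ?X @ [])"
    using l by (intro coxeter_eq_append_left)
  moreover have "coxeter_eq S m ((rev ?X @ ?X) @ ?Y) ([] @ ?Y)"
    using l diag by (intro coxeter_eq_append_right coxeter_eq_rev_cancel)
  ultimately have "coxeter_eq S m ?Y (rev ?X)"
    by (metis append_Nil append_Nil2 append_assoc coxeter_eq.sym coxeter_eq.trans)
  then show ?thesis by (simp add: rev_alt_word split: if_splits)
qed

lemma reduced_no_square:
  assumes "\<And>s. s \<in> S \<Longrightarrow> m s s = 1"
  shows "\<not> reduced S m (x @ [r, r])"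
proof
  assume "reduced S m (x @ [r, r])"
  then have r: "reduced S m [r, r]"
    using reduced_factor[of S m x "[r, r]" "[]"] by simp
  then have "r \<in> S" by (simp add: reduced_def)
  then have "coxeter_eq S m [r, r] []"
    using coxeter_eq.relator[of r S r m] assms by simp
  then show False using r by (auto simp: reduced_def)
qed

text \<open>
  A shortest word has no two equal adjacent letters, so over two letters it must alternate.
\<close>

lemma reduced_two_letters:
  assumes "reduced S m x" "x \<in> lists {s, t}" "\<And>s. s \<in> S \<Longrightarrow> m s s = 1"
  shows "x = alt_word s t (length x) \<or> x = alt_word t s (length x)"
  using assms(1,2)
proof (induction x rule: rev_induct)
  case (snoc r y)
  have "reduced S m y"
    using reduced_factor[of S m "[]" y "[r]"] snoc.prems by simp
  then have IH: "y = alt_word s t (length y) \<or> y = alt_word t s (length y)"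
    using snoc by simp
  have r: "r = s \<or> r = t" using snoc.prems by simp
  show ?case
  proof (cases y rule: rev_cases)
    case Nil
    then show ?thesis using r by auto
  next
    case (snoc z q)
    have "q \<noteq> r"
      using reduced_no_square[of S m z r] snoc.prems(1) assms(3) snoc by auto
    moreover have "(y = alt_word s t (length y) \<and> q = t) \<or> (y = alt_word t s (length y) \<and> q = s)"
      using IH snoc by auto
    ultimately show ?thesis using r by auto
  qed
qed simp

section \<open>A faithfulness criterion for actions of Coxeter groups\<close>

text \<open>
  Cones are taken with natural number coefficients, so that root coordinates may live in any abelian
  group, in particular in a lattice.
\<close>

inductive_set nonneg_span :: "'v::ab_group_add set \<Rightarrow> 'v set" for A where
  zero: "0 \<in> nonneg_span A"
| step: "x \<in> A \<Longrightarrow> y \<in> nonneg_span A \<Longrightarrow> x + y \<in> nonneg_span A"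

lemma nonneg_span_base: "x \<in> A \<Longrightarrow> x \<in> nonneg_span A"
  using nonneg_span.step[OF _ nonneg_span.zero] by fastforce

lemma nonneg_span_add:
  "x \<in> nonneg_span A \<Longrightarrow> y \<in> nonneg_span A \<Longrightarrow> x + y \<in> nonneg_span A"
  by (induction rule: nonneg_span.induct) (auto simp: add.assoc intro: nonneg_span.intros)

text \<open>
  These are the properties of the geometric representation on which Tits' argument rests.
  The assumption \<open>pointed\<close> says that no simple root is both positive and negative, and \<open>dihedral\<close> is
  the required positivity inside the rank two subgroups: there the alternating words with fewer than
  \<open>m s t\<close> letters that do not end in \<open>s\<close> keep \<open>\<alpha> s\<close> positive.  An entry \<open>m s t = 0\<close> stands for infinite
  order and so imposes positivity for every length.
\<close>

locale coxeter_root_action =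
  fixes S :: "'a set" and m :: "'a \<Rightarrow> 'a \<Rightarrow> nat"
    and \<rho> :: "'a \<Rightarrow> 'v::ab_group_add \<Rightarrow> 'v" and \<alpha> :: "'a \<Rightarrow> 'v"
  assumes diag: "s \<in> S \<Longrightarrow> m s s = 1"
    and additive: "\<rho> s (x + y) = \<rho> s x + \<rho> s y"
    and relator: "s \<in> S \<Longrightarrow> t \<in> S \<Longrightarrow> foldr \<rho> (concat (replicate (m s t) [s, t])) x = x"
    and reflects: "s \<in> S \<Longrightarrow> \<rho> s (\<alpha> s) = - \<alpha> s"
    and pointed: "s \<in> S \<Longrightarrow> - \<alpha> s \<notin> nonneg_span (\<alpha> ` S)"
    and dihedral: "s \<in> S \<Longrightarrow> t \<in> S \<Longrightarrow> s \<noteq> t \<Longrightarrow> m s t = 0 \<or> k < m s t \<Longrightarrow>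
      foldr \<rho> (alt_word s t k) (\<alpha> s) \<in> nonneg_span {\<alpha> s, \<alpha> t}"
begin

abbreviation act :: "'a list \<Rightarrow> 'v \<Rightarrow> 'v" where
  "act \<equiv> foldr \<rho>"

lemma act_add: "act u (x + y) = act u x + act u y"
  by (induction u) (auto simp: additive)

lemma act_zero [simp]: "act u 0 = 0"
  using act_add[of u 0 0] by simp

lemma act_minus: "act u (- x) = - act u x"
  using act_add[of u x "- x"] by (simp add: eq_neg_iff_add_eq_0 add.commute)

lemma act_nonneg_span:
  assumes "x \<in> nonneg_span A" "act u ` A \<subseteq> nonneg_span B"
  shows "act u x \<in> nonneg_span B"
  using assms(1)
proof induction
  case zero
  show ?case by (simp add: nonneg_span.zero)
next
  case (step x y)
  then show ?case using assms(2) by (auto simp: act_add intro: nonneg_span_add)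
qed

lemma act_coxeter_eq: "coxeter_eq S m u v \<Longrightarrow> act u = act v"
  by (induction rule: coxeter_eq.induct) (auto simp: fun_eq_iff relator)

text \<open>
  Induction on the length of \<open>w\<close>.  Let \<open>t \<noteq> s\<close> be the last letter of \<open>w\<close>, and write \<open>w\<close> as \<open>v @ x\<close>
  with \<open>x\<close> a word in \<open>s\<close> and \<open>t\<close> and \<open>v\<close> as short as possible.  By induction \<open>v\<close> keeps both \<open>\<alpha> s\<close> and
  \<open>\<alpha> t\<close> positive.  The alternating word \<open>x\<close> either can be made to end in \<open>s\<close>, or it keeps \<open>\<alpha> s\<close> inside the
  cone of \<open>\<alpha> s\<close> and \<open>\<alpha> t\<close>, which \<open>v\<close> then maps to positive vectors.
\<close>

lemma reduced_positive_or_descent: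
  assumes "reduced S m w" "s \<in> S"
  shows "act w (\<alpha> s) \<in> nonneg_span (\<alpha> ` S) \<or>
    (\<exists>w'. coxeter_eq S m w (w' @ [s]) \<and> length w = Suc (length w'))"
  using assms
proof (induction "length w" arbitrary: w s rule: less_induct)
  case less
  have lw: "w \<in> lists S" using less.prems by (simp add: reduced_def)
  show ?case
  proof (cases w rule: rev_cases)
    case Nil
    then show ?thesis using less.prems by (simp add: nonneg_span_base)
  next
    case (snoc w0 t)
    have t: "t \<in> S" using lw snoc by simp
    show ?thesis
    proof (cases "t = s")
      case True
      then show ?thesis using snoc lw by (intro disjI2 exI[of _ w0]) (use coxeter_eq.refl[OF lw] in simp)
    next
      case st: False
      define P where "P = (\<lambda>(v, x). v \<in> lists S \<and> x \<in> lists {s, t} \<and>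
        coxeter_eq S m w (v @ x) \<and> length v + length x = length w)"
      have "P (w0, [t])"
        using lw snoc coxeter_eq.refl[OF lw] by (simp add: P_def)
      from ex_has_least_nat[of P, OF this, of "length \<circ> fst"]
      obtain v x where P: "P (v, x)"
        and min': "\<And>v' x'. P (v', x') \<Longrightarrow> length v \<le> length v'"
        by fastforce
      have v: "v \<in> lists S" and x: "x \<in> lists {s, t}" and eq: "coxeter_eq S m w (v @ x)"
        and len: "length v + length x = length w"
        using P by (auto simp: P_def)
      have "length v \<le> length w0" using min' \<open>P (w0, [t])\<close> by blast
      then have short: "length v < length w" using snoc by simp
      have red: "reduced S m (v @ x)"
        using reduced_equiv[OF less.prems(1) eq] len by simp
      then have redv: "reduced S m v" and redx: "reduced S m x"
        using reduced_factor[of S m "[]" v x] reduced_factor[of S m v x "[]"] by simp_all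
      \<comment> \<open>A descent of \<open>v\<close> at \<open>s\<close> or \<open>t\<close> would move one more letter into \<open>x\<close>.\<close>
      have pos: "act v (\<alpha> r) \<in> nonneg_span (\<alpha> ` S)" if r: "r \<in> {s, t}" for r
      proof (rule ccontr)
        assume "\<not> ?thesis"
        moreover have "r \<in> S" using r t less.prems by auto
        ultimately obtain v' where v': "coxeter_eq S m v (v' @ [r])" "length v = Suc (length v')"
          using less.hyps[OF short redv] by blast
        have lx: "x \<in> lists S" using x t less.prems by auto
        have "coxeter_eq S m w ((v' @ [r]) @ x)"
          using coxeter_eq.trans[OF eq coxeter_eq_append_right[OF v'(1) lx]] .
        then have "P (v', r # x)"
          using coxeter_eq_lists[OF v'(1)] x r v'(2) len by (auto simp: P_def)
        then show False using min' v'(2) by fastforce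
      qed
      have ends_in_s: ?thesis
        if y: "coxeter_eq S m x (y @ [s])" "length x = Suc (length y)" for y
        using coxeter_eq.trans[OF eq coxeter_eq_append_left[OF y(1) v]] y(2) len
        by (intro disjI2 exI[of _ "v @ y"]) auto
      have lx: "x \<in> lists S" using x t less.prems by auto
      define k where "k = length x"
      from reduced_two_letters[OF redx x] diag
      consider "x = alt_word s t k" | "x = alt_word t s k" "k > 0"
        unfolding k_def by fastforce
      then show ?thesis
      proof cases
        case 2
        then obtain k' where k: "k = Suc k'" using gr0_conv_Suc by blast
        have "x = alt_word s t k' @ [s]" using 2 k by simp
        then show ?thesis
          using ends_in_s[of "alt_word s t k'"] coxeter_eq.refl[OF lx] by simp
      next
        case 1
        show ?thesis
        proof (cases "m s t = 0 \<or> k < m s t")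
          case True
          then have "act x (\<alpha> s) \<in> nonneg_span {\<alpha> s, \<alpha> t}"
            using dihedral less.prems(2) t st 1 by blast
          then have "act v (act x (\<alpha> s)) \<in> nonneg_span (\<alpha> ` S)"
            by (rule act_nonneg_span) (use pos in auto)
          then show ?thesis using act_coxeter_eq[OF eq] by simp
        next
          case False
          \<comment> \<open>The last \<open>m s t\<close> letters of \<open>x\<close> admit a braid move, after which \<open>x\<close> ends in \<open>s\<close>.\<close>
          then obtain n where n: "m s t = Suc n" using gr0_conv_Suc by blast
          have "k = (k - m s t) + m s t" using False by simp
          then obtain y where y: "x = y @ alt_word s t (m s t)"
            using 1 alt_word_add by metis
          have ly: "y \<in> lists S" using lx y by simp
          have "coxeter_eq S m x (y @ alt_word t s (m s t))"
            unfolding y using diag less.prems(2) t ly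
            by (intro coxeter_eq_append_left braid_relation)
          moreover have "alt_word t s (m s t) = alt_word s t n @ [s]" using n by simp
          ultimately show ?thesis
            using ends_in_s[of "y @ alt_word s t n"] y n by simp
        qed
      qed
    qed
  qed
qed

text \<open>
  For a shortest word \<open>v @ [s]\<close> acting trivially, \<open>v\<close> sends \<open>\<alpha> s\<close> to \<open>- \<alpha> s\<close>, which is not positive; so \<open>v\<close>
  can be rewritten to end in \<open>s\<close>, and then \<open>v @ [s]\<close> to end in \<open>s s\<close>, contradicting minimality.
\<close>

theorem faithful:
  assumes "u \<in> lists S" "act u = id"
  shows "coxeter_eq S m u []"
proof -
  obtain w where w: "coxeter_eq S m u w" "reduced S m w"
    using ex_reduced[OF assms(1)] by blast
  have "w = []"
  proof (cases w rule: rev_cases)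
    case (snoc v s)
    have lw: "v \<in> lists S" "s \<in> S" using w(2) snoc by (auto simp: reduced_def)
    have red: "reduced S m v" using reduced_factor[of S m "[]" v "[s]"] w(2) snoc by simp
    have "act w (\<alpha> s) = \<alpha> s"
      using act_coxeter_eq[OF w(1)] assms(2) by (metis id_apply)
    then have "act v (\<alpha> s) = - \<alpha> s"
      using lw reflects snoc by (simp add: act_minus neg_equal_iff_equal minus_equation_iff)
    then obtain v' where v': "coxeter_eq S m v (v' @ [s])" "length v = Suc (length v')"
      using reduced_positive_or_descent[OF red lw(2)] pointed[OF lw(2)] by metis
    have "coxeter_eq S m w ((v' @ [s]) @ [s])"
      unfolding snoc using v' lw by (intro coxeter_eq_append_right) auto
    then have "reduced S m (v' @ [s, s])"
      using reduced_equiv[OF w(2)] v'(2) snoc by simp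
    then show ?thesis using reduced_no_square[of S m v' s] diag by blast
  qed
  then show ?thesis using w(1) by simp
qed

corollary coxeter_eq_iff_act:
  assumes "u \<in> lists S" "v \<in> lists S"
  shows "coxeter_eq S m u v \<longleftrightarrow> act u = act v"
proof
  assume eq: "act u = act v"
  have vv: "coxeter_eq S m (rev v @ v) []"
    using diag assms(2) by (intro coxeter_eq_rev_cancel)
  have v': "coxeter_eq S m (v @ rev v) []"
    using coxeter_eq_rev_cancel[of S m "rev v"] diag assms(2) by (simp add: in_lists_conv_set)
  have "act (rev v @ u) = act (rev v @ v)" by (intro ext) (simp add: eq)
  then have "act (rev v @ u) = id" using act_coxeter_eq[OF vv] by (simp add: fun_eq_iff)
  then have "coxeter_eq S m (rev v @ u) []" using assms by (intro faithful) auto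
  then have "coxeter_eq S m (v @ rev v @ u) v"
    using coxeter_eq_append_left[of S m "rev v @ u" "[]" v] assms by simp
  moreover have "coxeter_eq S m ((v @ rev v) @ u) u"
    using coxeter_eq_append_right[OF v', of u] assms by simp
  ultimately show "coxeter_eq S m u v"
    by (metis append_assoc coxeter_eq.sym coxeter_eq.trans)
qed (rule act_coxeter_eq)

end

section \<open>The root system of type F4\<close>

type_synonym vec4 = "int \<times> int \<times> int \<times> int"

text \<open>
  Vectors are written in coordinates with respect to the simple roots; roots 1 and 2 are long, roots 3 and 4
  are short.  The coefficient 2 in the third reflection reflects the double bond: a long root has
  Cartan integer -2 with respect to its short neighbour, while the short root has -1 with respect to its
  long neighbour.
\<close>

fun f4_reflection :: "nat \<Rightarrow> vec4 \<Rightarrow> vec4" where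
  "f4_reflection s (a, b, c, d) =
    (if s = 1 then (b - a, b, c, d)
     else if s = 2 then (a, a + c - b, c, d)
     else if s = 3 then (a, b, 2 * b + d - c, d)
     else (a, b, c, c - d))"

definition f4_root :: "nat \<Rightarrow> vec4" where
  "f4_root s =
    (if s = 1 then (1, 0, 0, 0) else if s = 2 then (0, 1, 0, 0)
     else if s = 3 then (0, 0, 1, 0) else (0, 0, 0, 1))"

lemma F4_generator_cases:
  assumes "s \<in> {1..4::nat}"
  obtains "s = 1" | "s = 2" | "s = 3" | "s = 4"
  using assms by (fastforce simp: numeral_eq_Suc le_Suc_eq)

lemma F4_matrix_values:
  "F4_matrix 1 1 = 1" "F4_matrix 1 2 = 3" "F4_matrix 1 3 = 2" "F4_matrix 1 4 = 2"
  "F4_matrix 2 1 = 3" "F4_matrix 2 2 = 1" "F4_matrix 2 3 = 4" "F4_matrix 2 4 = 2"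
  "F4_matrix 3 1 = 2" "F4_matrix 3 2 = 4" "F4_matrix 3 3 = 1" "F4_matrix 3 4 = 3"
  "F4_matrix 4 1 = 2" "F4_matrix 4 2 = 2" "F4_matrix 4 3 = 3" "F4_matrix 4 4 = 1"
  by (simp_all add: F4_matrix_def doubleton_eq_iff)

lemma nonneg_span_small:
  fixes x y :: "'v::ab_group_add"
  shows "x \<in> nonneg_span {x, y}" "y \<in> nonneg_span {x, y}" "x + y \<in> nonneg_span {x, y}"
    "x + y + y \<in> nonneg_span {x, y}"
proof -
  show x: "x \<in> nonneg_span {x, y}" and y: "y \<in> nonneg_span {x, y}"
    by (simp_all add: nonneg_span_base)
  then show "x + y \<in> nonneg_span {x, y}" "x + y + y \<in> nonneg_span {x, y}"
    by (simp_all only: nonneg_span_add)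
qed

interpretation F4: coxeter_root_action "{1..4}" F4_matrix f4_reflection f4_root
proof
  show "F4_matrix s s = 1" for s by (simp add: F4_matrix_def)
next
  fix s and x y :: vec4
  show "f4_reflection s (x + y) = f4_reflection s x + f4_reflection s y"
    by (cases x; cases y) (simp add: algebra_simps)
next
  fix s t :: nat and x :: vec4
  assume s: "s \<in> {1..4}" and t: "t \<in> {1..4}"
  show "foldr f4_reflection (concat (replicate (F4_matrix s t) [s, t])) x = x"
    by (cases x; rule F4_generator_cases[OF s]; rule F4_generator_cases[OF t];
        simp only: F4_matrix_values; simp add: eval_nat_numeral)
next
  fix s assume "s \<in> {1..4::nat}"
  then show "f4_reflection s (f4_root s) = - f4_root s"
    by (cases rule: F4_generator_cases) (simp_all add: f4_root_def)
next
  fix s assume s: "s \<in> {1..4::nat}"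
  have nonneg: "fst x \<ge> 0 \<and> fst (snd x) \<ge> 0 \<and> fst (snd (snd x)) \<ge> 0 \<and> snd (snd (snd x)) \<ge> 0"
    if "x \<in> nonneg_span (f4_root ` {1..4})" for x
    using that by induction (auto simp: f4_root_def)
  show "- f4_root s \<notin> nonneg_span (f4_root ` {1..4})"
  proof
    assume "- f4_root s \<in> nonneg_span (f4_root ` {1..4})"
    note pos = nonneg[OF this]
    show False by (rule F4_generator_cases[OF s]) (use pos in \<open>simp_all add: f4_root_def\<close>)
  qed
next
  fix s t k :: nat
  assume s: "s \<in> {1..4}" and t: "t \<in> {1..4}" and "s \<noteq> t"
    and k: "F4_matrix s t = 0 \<or> k < F4_matrix s t"
  let ?x = "foldr f4_reflection (alt_word s t k) (f4_root s)"
  have "F4_matrix s t \<noteq> 0" "F4_matrix s t \<le> 4" by (simp_all add: F4_matrix_def)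
  then consider "k = 0" | "k = 1" | "k = 2" "F4_matrix s t > 2" | "k = 3" "F4_matrix s t > 3"
    using k by linarith
  \<comment> \<open>Entries 2 and 3 of the matrix give the values \<open>\<alpha> s\<close>, \<open>\<alpha> t\<close> and their sum; the entry 4 also gives
    \<open>\<alpha> s + 2 \<alpha> t\<close>, in the case where \<open>s\<close> is long.\<close>
  then have "?x = f4_root s \<or> ?x = f4_root t \<or> ?x = f4_root s + f4_root t \<or>
      ?x = f4_root s + f4_root t + f4_root t"
    by (cases; rule F4_generator_cases[OF s]; rule F4_generator_cases[OF t])
      (use \<open>s \<noteq> t\<close> in \<open>simp_all add: F4_matrix_values[unfolded One_nat_def] f4_root_def\<close>,
        simp_all add: numeral_2_eq_2 numeral_3_eq_3)
  then show "?x \<in> nonneg_span {f4_root s, f4_root t}"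
    by (elim disjE) (simp_all only: nonneg_span_small)
qed

definition f4_scale :: "int \<Rightarrow> vec4 \<Rightarrow> vec4" where
  "f4_scale n = (\<lambda>(a, b, c, d). (n * a, n * b, n * c, n * d))"

lemma act_scale: "F4.act u (f4_scale n x) = f4_scale n (F4.act u x)"
proof (induction u)
  case (Cons s u)
  have "f4_reflection s (f4_scale n y) = f4_scale n (f4_reflection s y)" for y
    by (cases y) (simp add: f4_scale_def algebra_simps)
  with Cons show ?case by simp
qed simp

text \<open>
  The four vectors are long roots spanning a sublattice of index 4: twice any lattice vector is
  an integral combination of them.  So the images of this frame determine the action of a word, and
  equality of elements becomes a finite comparison; at the same time fixing all long roots is seen
  to force trivial action.
\<close>

definition f4_frame_images :: "nat list \<Rightarrow> vec4 list" where
  "f4_frame_images u = map (F4.act u) [(1, 0, 0, 0), (0, 1, 0, 0), (0, 1, 2, 0), (0, 1, 2, 2)]"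

lemma act_eq_iff_frame: "F4.act u = F4.act v \<longleftrightarrow> f4_frame_images u = f4_frame_images v"
proof
  assume eq: "f4_frame_images u = f4_frame_images v"
  show "F4.act u = F4.act v"
  proof
    fix x :: vec4
    obtain a b c d where x: "x = (a, b, c, d)" by (cases x)
    have "f4_scale 2 x = f4_scale (2 * a) (1, 0, 0, 0) + f4_scale (2 * b - c) (0, 1, 0, 0)
        + f4_scale (c - d) (0, 1, 2, 0) + f4_scale d (0, 1, 2, 2)"
      by (simp add: x f4_scale_def)
    then have "F4.act u (f4_scale 2 x) = F4.act v (f4_scale 2 x)"
      using eq by (simp add: f4_frame_images_def F4.act_add act_scale)
    then have "f4_scale 2 (F4.act u x) = f4_scale 2 (F4.act v x)"
      by (simp only: act_scale)
    then show "F4.act u x = F4.act v x"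
      by (cases "F4.act u x"; cases "F4.act v x") (simp add: f4_scale_def)
  qed
qed (simp add: f4_frame_images_def)

definition f4_long_roots :: "vec4 list" where
  "f4_long_roots =
    [(1, 0, 0, 0), (0, 1, 0, 0), (1, 1, 0, 0), (0, 1, 2, 0), (1, 1, 2, 0), (1, 2, 2, 0),
     (0, 1, 2, 2), (1, 1, 2, 2), (1, 2, 2, 2), (1, 2, 4, 2), (1, 3, 4, 2), (2, 3, 4, 2),
     (-1, 0, 0, 0), (0, -1, 0, 0), (-1, -1, 0, 0), (0, -1, -2, 0), (-1, -1, -2, 0), (-1, -2, -2, 0),
     (0, -1, -2, -2), (-1, -1, -2, -2), (-1, -2, -2, -2), (-1, -2, -4, -2), (-1, -3, -4, -2), (-2, -3, -4, -2)]"

lemma card_f4_long_roots: "card (set f4_long_roots) = 24"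
proof -
  have "distinct f4_long_roots" by (simp add: f4_long_roots_def)
  then have "card (set f4_long_roots) = length f4_long_roots" by (rule distinct_card)
  then show ?thesis by (simp add: f4_long_roots_def)
qed

lemma act_f4_long_roots:
  assumes "u \<in> lists {1..4}" "x \<in> set f4_long_roots"
  shows "F4.act u x \<in> set f4_long_roots"
  using assms
proof (induction u)
  case (Cons s u)
  have "list_all (\<lambda>s. list_all (\<lambda>y. f4_reflection s y \<in> set f4_long_roots) f4_long_roots) [1, 2, 3, 4]"
    by code_simp
  moreover have "s \<in> set [1, 2, 3, 4]"
    using Cons.hyps by (auto elim: F4_generator_cases)
  ultimately have "\<forall>y\<in>set f4_long_roots. f4_reflection s y \<in> set f4_long_roots"
    unfolding list_all_iff by blast
  then show ?case using Cons by simp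
qed simp

section \<open>Elements of the Coxeter group\<close>

abbreviation f4_elem :: "nat list \<Rightarrow> nat list set" where
  "f4_elem u \<equiv> coxeter_rel {1..4} F4_matrix `` {u}"

lemma carrier_W_F4: "carrier W_F4 = f4_elem ` lists {1..4}"
  by (auto simp: W_F4_def coxeter_group_def quotient_def)

lemma one_W_F4: "\<one>\<^bsub>W_F4\<^esub> = f4_elem []"
  by (simp add: W_F4_def coxeter_group_def)

lemma f4_elem_mult:
  "u \<in> lists {1..4} \<Longrightarrow> v \<in> lists {1..4} \<Longrightarrow> f4_elem u \<otimes>\<^bsub>W_F4\<^esub> f4_elem v = f4_elem (u @ v)"
  unfolding W_F4_def by (rule coxeter_group_mult)

lemma f4_elem_eq_iff_act:
  "u \<in> lists {1..4} \<Longrightarrow> v \<in> lists {1..4} \<Longrightarrow> f4_elem u = f4_elem v \<longleftrightarrow> F4.act u = F4.act v"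
  by (simp only: coxeter_class_eq_iff F4.coxeter_eq_iff_act)

text \<open>
  By faithfulness, the word problem of the presented group is decided by comparing frame images; the explicit
  identities between elements used in the lower bound are settled in this way.
\<close>

lemma f4_elem_eq_iff:
  "u \<in> lists {1..4} \<Longrightarrow> v \<in> lists {1..4} \<Longrightarrow>
    f4_elem u = f4_elem v \<longleftrightarrow> f4_frame_images u = f4_frame_images v"
  by (simp only: f4_elem_eq_iff_act act_eq_iff_frame)

section \<open>The embedding by the action on long roots\<close>

lemma faithful_action_imp_mon:
  assumes "finite X"
    and bij: "\<And>g. g \<in> carrier G \<Longrightarrow> bij_betw (\<phi> g) X X"
    and mult: "\<And>g h x. g \<in> carrier G \<Longrightarrow> h \<in> carrier G \<Longrightarrow> x \<in> X \<Longrightarrow>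
      \<phi> (g \<otimes>\<^bsub>G\<^esub> h) x = \<phi> g (\<phi> h x)"
    and faithful: "\<And>g h. g \<in> carrier G \<Longrightarrow> h \<in> carrier G \<Longrightarrow> \<forall>x\<in>X. \<phi> g x = \<phi> h x \<Longrightarrow> g = h"
  shows "mon G (sym_group (card X)) \<noteq> {}"
proof -
  let ?I = "{1..card X}"
  obtain e where e: "bij_betw e ?I X"
    using ex_bij_betw_nat_finite_1[OF assms(1)] by blast
  let ?d = "inv_into ?I e"
  have d: "bij_betw ?d X ?I" using e by (rule bij_betw_inv_into)
  have ed: "e (?d x) = x" if "x \<in> X" for x
    using bij_betw_inv_into_right[OF e that] .
  have eI: "e i \<in> X" if "i \<in> ?I" for i
    using e that by (rule bij_betwE[rule_format])
  have dI: "?d x \<in> ?I" if "x \<in> X" for x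
    using d that by (rule bij_betwE[rule_format])
  have \<phi>X: "\<phi> g x \<in> X" if "g \<in> carrier G" "x \<in> X" for g x
    using bij[OF that(1)] that(2) by (rule bij_betwE[rule_format])
  define F where "F g i = (if i \<in> ?I then ?d (\<phi> g (e i)) else i)" for g i
  have "F g permutes ?I" if "g \<in> carrier G" for g
  proof (rule bij_imp_permutes)
    have "bij_betw (?d \<circ> (\<phi> g \<circ> e)) ?I ?I"
      using e bij[OF that] d by (blast intro: bij_betw_trans)
    then show "bij_betw (F g) ?I ?I"
      by (rule bij_betw_cong[THEN iffD1, rotated]) (simp add: F_def)
  qed (simp only: F_def if_False)
  moreover have "F (g \<otimes>\<^bsub>G\<^esub> h) = F g \<circ> F h" if "g \<in> carrier G" "h \<in> carrier G" for g h
  proof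
    fix i
    show "F (g \<otimes>\<^bsub>G\<^esub> h) i = (F g \<circ> F h) i"
    proof (cases "i \<in> ?I")
      case True
      then have "\<phi> h (e i) \<in> X" using that eI \<phi>X by blast
      then show ?thesis
        using that True dI ed eI by (simp add: F_def mult del: atLeastAtMost_iff)
    qed (simp only: F_def o_apply if_False)
  qed
  moreover have "inj_on F (carrier G)"
  proof (rule inj_onI)
    fix g h assume gh: "g \<in> carrier G" "h \<in> carrier G" "F g = F h"
    have "\<phi> g x = \<phi> h x" if "x \<in> X" for x
    proof -
      have "?d (\<phi> g x) = ?d (\<phi> h x)"
        using fun_cong[OF gh(3), of "?d x"] by (simp only: F_def dI[OF that] ed[OF that] if_True)
      then show ?thesis using ed[OF \<phi>X[OF gh(1) that]] ed[OF \<phi>X[OF gh(2) that]] by metis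
    qed
    then show "g = h" using faithful gh by blast
  qed
  ultimately have "F \<in> mon G (sym_group (card X))"
    by (auto simp: mon_def hom_def sym_group_def)
  then show ?thesis by blast
qed

text \<open>
  A class of words acts through any of its members, since equivalent words act alike.
\<close>

lemma W_F4_embeds: "mon W_F4 (sym_group 24) \<noteq> {}"
proof -
  define \<phi> where "\<phi> A = F4.act (SOME w. w \<in> A)" for A
  have \<phi>: "\<phi> (f4_elem u) = F4.act u" if "u \<in> lists {1..4}" for u
  proof -
    have "u \<in> f4_elem u" using coxeter_eq.refl[OF that] by (simp add: coxeter_rel_def)
    then have "(SOME w. w \<in> f4_elem u) \<in> f4_elem u" by (rule someI)
    then show ?thesis
      unfolding \<phi>_def by (simp add: coxeter_rel_def F4.act_coxeter_eq)
  qed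
  have bij: "bij_betw (F4.act u) (set f4_long_roots) (set f4_long_roots)"
    if u: "u \<in> lists {1..4}" for u
  proof (rule bij_betwI[where g = "F4.act (rev u)"])
    have r: "rev u \<in> lists {1..4}" using u by auto
    show "F4.act u \<in> set f4_long_roots \<rightarrow> set f4_long_roots"
      "F4.act (rev u) \<in> set f4_long_roots \<rightarrow> set f4_long_roots"
      using u r by (blast intro: act_f4_long_roots)+
    fix x
    have "F4.act (rev v @ v) x = x" if "v \<in> lists {1..4}" for v
      using F4.act_coxeter_eq[OF coxeter_eq_rev_cancel[OF F4.diag that]] by simp
    from this[OF u] this[OF r] show "F4.act (rev u) (F4.act u x) = x" "F4.act u (F4.act (rev u) x) = x"
      by simp_all
  qed
  have "mon W_F4 (sym_group (card (set f4_long_roots))) \<noteq> {}"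
  proof (rule faithful_action_imp_mon[where \<phi> = \<phi>])
    fix g h assume "g \<in> carrier W_F4" "h \<in> carrier W_F4"
    then obtain u v where u: "u \<in> lists {1..4}" "g = f4_elem u" and v: "v \<in> lists {1..4}" "h = f4_elem v"
      by (auto simp: carrier_W_F4)
    have uv: "u @ v \<in> lists {1..4}" using u v by simp
    show "bij_betw (\<phi> g) (set f4_long_roots) (set f4_long_roots)"
      using bij u by (simp only: \<phi>)
    show "\<phi> (g \<otimes>\<^bsub>W_F4\<^esub> h) x = \<phi> g (\<phi> h x)" for x
      by (simp only: u(2) v(2) f4_elem_mult[OF u(1) v(1)] \<phi>[OF u(1)] \<phi>[OF v(1)] \<phi>[OF uv]) simp
    assume "\<forall>x\<in>set f4_long_roots. \<phi> g x = \<phi> h x"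
    then have "\<forall>x\<in>set f4_long_roots. F4.act u x = F4.act v x"
      by (simp only: u(2) v(2) \<phi>[OF u(1)] \<phi>[OF v(1)])
    then have "f4_frame_images u = f4_frame_images v"
      by (simp add: f4_frame_images_def f4_long_roots_def)
    then show "g = h" using u v by (simp only: f4_elem_eq_iff)
  qed simp
  then show ?thesis unfolding card_f4_long_roots .
qed

section \<open>Semiregular subgroups and the lower bound\<close>

text \<open>
  Every orbit is in bijection with \<open>K\<close>, so \<open>N\<close> is a disjoint union of sets of size \<open>card K\<close>.
\<close>

lemma semiregular_card_dvd:
  assumes G: "group G" and f: "f \<in> hom G (sym_group m)" and K: "subgroup K G" and N: "finite N"
    and inv: "\<And>k x. k \<in> K \<Longrightarrow> x \<in> N \<Longrightarrow> f k x \<in> N"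
    and free: "\<And>k x. k \<in> K \<Longrightarrow> x \<in> N \<Longrightarrow> f k x = x \<Longrightarrow> k = \<one>\<^bsub>G\<^esub>"
  shows "card K dvd card N"
proof -
  interpret group_hom G "sym_group m" f
    using G f by (simp add: group_hom_def group_hom_axioms_def sym_group_is_group)
  have Kc: "k \<in> carrier G" if "k \<in> K" for k using subgroup.mem_carrier[OF K that] .
  have one: "f \<one>\<^bsub>G\<^esub> x = x" for x using hom_one by (simp add: sym_group_def)
  have mult: "f (g \<otimes>\<^bsub>G\<^esub> h) x = f g (f h x)" if "g \<in> K" "h \<in> K" for g h x
    using hom_mult[of g h] Kc that by (simp add: sym_group_def)
  define r where "r = {(x, y). x \<in> N \<and> (\<exists>k\<in>K. y = f k x)}"
  have "equiv N r"
  proof (rule equivI)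
    show "r \<subseteq> N \<times> N" using inv by (auto simp: r_def)
    show "refl_on N r"
      using subgroup.one_closed[OF K] one by (auto simp: r_def intro!: refl_onI bexI[of _ "\<one>\<^bsub>G\<^esub>"])
    show "sym r"
    proof (rule symI)
      fix x y assume "(x, y) \<in> r"
      then obtain k where k: "x \<in> N" "k \<in> K" "y = f k x" by (auto simp: r_def)
      have k': "inv\<^bsub>G\<^esub> k \<in> K" using subgroup.m_inv_closed[OF K k(2)] .
      have "f (inv\<^bsub>G\<^esub> k) y = x"
        using mult[OF k' k(2), of x] Kc[OF k(2)] one k(3) by simp
      then show "(y, x) \<in> r" using k k' inv by (auto simp: r_def intro!: bexI[of _ "inv\<^bsub>G\<^esub> k"])
    qed
    show "trans r"
    proof (rule transI)
      fix x y z assume "(x, y) \<in> r" "(y, z) \<in> r"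
      then obtain k l where "x \<in> N" "k \<in> K" "l \<in> K" "z = f l (f k x)" by (auto simp: r_def)
      then show "(x, z) \<in> r"
        using mult[of l k x] subgroup.m_closed[OF K, of l k]
        by (auto simp: r_def intro!: bexI[of _ "l \<otimes>\<^bsub>G\<^esub> k"])
    qed
  qed
  moreover have "card K dvd card X" if X: "X \<in> N // r" for X
  proof -
    obtain x where x: "x \<in> N" "X = r `` {x}" using X by (auto elim: quotientE)
    have "X = (\<lambda>k. f k x) ` K" using x by (auto simp: r_def)
    moreover have "inj_on (\<lambda>k. f k x) K"
    proof (rule inj_onI)
      fix k l assume kl: "k \<in> K" "l \<in> K" "f k x = f l x"
      have l': "inv\<^bsub>G\<^esub> l \<in> K" using subgroup.m_inv_closed[OF K kl(2)] .
      have "f (inv\<^bsub>G\<^esub> l \<otimes>\<^bsub>G\<^esub> k) x = f (inv\<^bsub>G\<^esub> l \<otimes>\<^bsub>G\<^esub> l) x"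
        using mult l' kl by simp
      then have "inv\<^bsub>G\<^esub> l \<otimes>\<^bsub>G\<^esub> k = \<one>\<^bsub>G\<^esub>"
        using free[OF subgroup.m_closed[OF K l' kl(1)] x(1)] Kc[OF kl(2)] one by simp
      then show "k = l"
        using Kc kl by (metis G.inv_equality G.inv_inv G.inv_closed)
    qed
    ultimately show ?thesis by (simp add: card_image)
  qed
  ultimately show ?thesis using equiv_imp_dvd_card N by blast
qed

text \<open>
  The points moved by both \<open>z\<close> and \<open>a\<close> are permuted semiregularly by \<open>K\<close> and by \<open>A\<close>, because fixing
  a point passes to powers.  If there were no such point, then the elements acting trivially on the set of
  points moved by \<open>z\<close> would form a normal subgroup containing \<open>a\<close>, hence \<open>z\<close>, and \<open>z\<close> would move nothing.
\<close>

theorem card_mult_card_le_degree: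
  assumes G: "group G" and f: "f \<in> mon G (sym_group m)"
    and z: "z \<in> carrier G" "z \<noteq> \<one>\<^bsub>G\<^esub>" and a: "a \<in> carrier G"
    and central: "\<And>g. g \<in> carrier G \<Longrightarrow> g \<otimes>\<^bsub>G\<^esub> z = z \<otimes>\<^bsub>G\<^esub> g"
    and closure: "\<And>L. L \<lhd> G \<Longrightarrow> a \<in> L \<Longrightarrow> z \<in> L"
    and K: "subgroup K G" "\<And>k. k \<in> K \<Longrightarrow> k \<otimes>\<^bsub>G\<^esub> a = a \<otimes>\<^bsub>G\<^esub> k"
      "\<And>k. k \<in> K \<Longrightarrow> k \<noteq> \<one>\<^bsub>G\<^esub> \<Longrightarrow> \<exists>n::nat. k [^]\<^bsub>G\<^esub> n = z"
    and A: "subgroup A G" "\<And>b. b \<in> A \<Longrightarrow> b \<otimes>\<^bsub>G\<^esub> a = a \<otimes>\<^bsub>G\<^esub> b"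
      "\<And>b. b \<in> A \<Longrightarrow> b \<noteq> \<one>\<^bsub>G\<^esub> \<Longrightarrow> \<exists>n::nat. b [^]\<^bsub>G\<^esub> n = a"
    and coprime: "coprime (card A) (card K)"
  shows "card A * card K \<le> m"
proof -
  have hom: "f \<in> hom G (sym_group m)" and inj: "inj_on f (carrier G)"
    using f by (auto simp: mon_def)
  interpret group_hom G "sym_group m" f
    using G hom by (simp add: group_hom_def group_hom_axioms_def sym_group_is_group)
  note [simp del] = hom_one hom_mult hom_inv
  have one: "f \<one>\<^bsub>G\<^esub> = id" using hom_one by (simp add: sym_group_def)
  have mult: "f (g \<otimes>\<^bsub>G\<^esub> h) x = f g (f h x)" if "g \<in> carrier G" "h \<in> carrier G" for g h x
    using hom_mult[of g h] that by (simp add: sym_group_def)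
  have perm: "f g permutes {1..m}" if "g \<in> carrier G" for g
    using hom_closed[OF that] by (simp add: sym_group_def)
  have pow: "f (g [^]\<^bsub>G\<^esub> n) x = x" if "g \<in> carrier G" "f g x = x" for g x and n :: nat
    using that by (induction n) (simp_all add: one mult)
  have moved: "f b (f g x) \<noteq> f g x"
    if "g \<in> carrier G" "b \<in> carrier G" "g \<otimes>\<^bsub>G\<^esub> b = b \<otimes>\<^bsub>G\<^esub> g" "f b x \<noteq> x" for b g x
  proof -
    have "f b (f g x) = f g (f b x)"
      using mult[OF that(1,2), of x] mult[OF that(2,1), of x] that(3) by metis
    then show ?thesis using inj_eq[OF permutes_inj[OF perm[OF that(1)]]] that(4) by simp
  qed
  define N where "N = {x. f z x \<noteq> x \<and> f a x \<noteq> x}"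
  have "N \<subseteq> {1..m}" using perm[OF z(1)] by (auto simp: N_def permutes_def)
  then have N: "finite N" "card N \<le> m" using card_mono[of "{1..m}" N] finite_subset[of N "{1..m}"] by simp_all
  have dvd: "card H dvd card N"
    if H: "subgroup H G" "\<And>h. h \<in> H \<Longrightarrow> h \<otimes>\<^bsub>G\<^esub> a = a \<otimes>\<^bsub>G\<^esub> h"
      "\<And>h. h \<in> H \<Longrightarrow> h \<noteq> \<one>\<^bsub>G\<^esub> \<Longrightarrow> \<exists>n::nat. h [^]\<^bsub>G\<^esub> n \<in> {a, z}" for H
  proof (rule semiregular_card_dvd[OF G hom H(1) N(1)])
    fix h x assume h: "h \<in> H" and x: "x \<in> N"
    have hc: "h \<in> carrier G" using subgroup.mem_carrier[OF H(1) h] .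
    show "f h x \<in> N"
      using x moved[OF hc z(1) central[OF hc]] moved[OF hc a H(2)[OF h]] by (simp add: N_def)
    assume "f h x = x"
    then have "f (h [^]\<^bsub>G\<^esub> n) x = x" for n :: nat using pow hc by blast
    then show "h = \<one>\<^bsub>G\<^esub>" using H(3)[OF h] x unfolding N_def by fastforce
  qed
  have "card A dvd card N" "card K dvd card N"
    using dvd[OF A(1,2)] A(3) dvd[OF K(1,2)] K(3) by simp_all blast+
  then have "card A * card K dvd card N"
    using coprime by (rule divides_mult)
  moreover have "card N \<noteq> 0"
  proof
    assume "card N = 0"
    then have fix_a: "f a x = x" if "f z x \<noteq> x" for x using that N(1) by (auto simp: N_def)
    \<comment> \<open>As \<open>z\<close> is central, the set of points that it moves is invariant under the whole group.\<close>
    define L where "L = {g \<in> carrier G. \<forall>x. f z x \<noteq> x \<longrightarrow> f g x = x}"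
    have inv_id: "f (inv\<^bsub>G\<^esub> g) (f g x) = x" "f g (f (inv\<^bsub>G\<^esub> g) x) = x" if "g \<in> carrier G" for g x
      using mult[of "inv\<^bsub>G\<^esub> g" g x] mult[of g "inv\<^bsub>G\<^esub> g" x] that
      by (simp_all add: one del: sym_group_inv_equality)
    have "subgroup L G"
    proof (rule G.subgroupI)
      show "L \<subseteq> carrier G" by (auto simp: L_def)
      show "L \<noteq> {}" using one by (auto simp: L_def)
      show "inv\<^bsub>G\<^esub> g \<in> L" if "g \<in> L" for g
      proof -
        have g: "g \<in> carrier G" and fx: "\<And>x. f z x \<noteq> x \<Longrightarrow> f g x = x"
          using that by (auto simp: L_def)
        have "f (inv\<^bsub>G\<^esub> g) x = x" if "f z x \<noteq> x" for x
          using inv_id(1)[OF g, of x] fx[OF that] by metis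
        then show ?thesis using g by (simp add: L_def)
      qed
      show "g \<otimes>\<^bsub>G\<^esub> h \<in> L" if "g \<in> L" "h \<in> L" for g h
        using that mult by (auto simp: L_def)
    qed
    moreover have "g \<otimes>\<^bsub>G\<^esub> h \<otimes>\<^bsub>G\<^esub> inv\<^bsub>G\<^esub> g \<in> L" if g: "g \<in> carrier G" and h: "h \<in> L" for g h
    proof -
      have hc: "h \<in> carrier G" using h by (simp add: L_def)
      have "f (g \<otimes>\<^bsub>G\<^esub> h \<otimes>\<^bsub>G\<^esub> inv\<^bsub>G\<^esub> g) x = x" if "f z x \<noteq> x" for x
      proof -
        have "f h (f (inv\<^bsub>G\<^esub> g) x) = f (inv\<^bsub>G\<^esub> g) x"
          using h moved[of "inv\<^bsub>G\<^esub> g" z x] central z(1) g that by (simp add: L_def)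
        then show ?thesis using g hc inv_id(2) by (simp add: mult)
      qed
      then show ?thesis using g hc by (simp add: L_def)
    qed
    ultimately have "L \<lhd> G" by (rule G.normal_invI)
    moreover have "a \<in> L" using a fix_a by (simp add: L_def)
    ultimately have "z \<in> L" by (rule closure)
    then have "f z = f \<one>\<^bsub>G\<^esub>" by (auto simp: L_def one)
    then show False using inj_onD[OF inj] z by auto
  qed
  ultimately show ?thesis using N(2) by (meson dvd_imp_le le_trans not_gr0)
qed

section \<open>Commuting subgroups of orders 3 and 8\<close>

text \<open>
  The Coxeter element \<open>c = s\<^sub>1 s\<^sub>2 s\<^sub>3 s\<^sub>4\<close> has order 12 and rotates two planes by 30 and 150 degrees.  In terms of
  quaternions it is \<open>x \<mapsto> l x r\<close> with units \<open>l\<close> of order 4 and \<open>r\<close> of order 6.  Hence \<open>c\<^sup>3\<close> is multiplication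
  from the left by \<open>- l\<^sup>3\<close>, of order 4, while \<open>c\<^sup>4\<close> is multiplication from the right by \<open>r\<^sup>4\<close>, of order 3, and
  \<open>c\<^sup>6 = -1\<close>.  Conjugation by the rotation \<open>s\<^sub>1 s\<^sub>2\<close> preserves the two sides and turns \<open>c\<^sup>3\<close> into left
  multiplication by an orthogonal unit of order 4; together they generate the quaternion group.
\<close>

definition f4_coxeter_power :: "nat \<Rightarrow> nat list" where
  "f4_coxeter_power n = concat (replicate n [1, 2, 3, 4])"

definition f4_quaternion_words :: "nat list list" where
  "f4_quaternion_words =
    (let z = f4_coxeter_power 6; i = f4_coxeter_power 3; j = [1, 2] @ i @ [2, 1]
     in [[], i, j, i @ j, z, z @ i, z @ j, z @ i @ j])"

definition f4_cyclic_words :: "nat list list" where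
  "f4_cyclic_words = [[], f4_coxeter_power 4, f4_coxeter_power 8]"

lemma f4_coxeter_power_lists: "f4_coxeter_power n \<in> lists {1..4}"
  by (induction n) (auto simp: f4_coxeter_power_def)

lemma f4_words_lists:
  "set f4_quaternion_words \<subseteq> lists {1..4}" "set f4_cyclic_words \<subseteq> lists {1..4}"
  using f4_coxeter_power_lists
  by (auto simp: f4_quaternion_words_def f4_cyclic_words_def Let_def)

text \<open>
  Distinctness of the frames makes the orders of the subgroups exactly 8 and 3.  Powers with exponent 1
  and 2 suffice: the units \<open>\<plusminus>i, \<plusminus>j, \<plusminus>k\<close> square to \<open>-1\<close>, and the square of \<open>c\<^sup>8\<close> is \<open>c\<^sup>4\<close>.
\<close>

lemma f4_quaternion_words_closed:
  "\<forall>u\<in>set f4_quaternion_words. \<forall>v\<in>set f4_quaternion_words.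
    f4_frame_images (u @ v) \<in> set (map f4_frame_images f4_quaternion_words)"
  by code_simp

lemma f4_quaternion_words_inverse:
  "\<forall>u\<in>set f4_quaternion_words. \<exists>v\<in>set f4_quaternion_words.
    f4_frame_images (v @ u) = f4_frame_images []"
  by code_simp

lemma f4_quaternion_words_distinct: "distinct (map f4_frame_images f4_quaternion_words)"
  by code_simp

lemma f4_quaternion_words_power:
  "\<forall>u\<in>set f4_quaternion_words. f4_frame_images u = f4_frame_images [] \<or>
    f4_frame_images u = f4_frame_images (f4_coxeter_power 6) \<or>
    f4_frame_images (u @ u) = f4_frame_images (f4_coxeter_power 6)"
  by code_simp

lemma f4_quaternion_words_commute:
  "\<forall>u\<in>set f4_quaternion_words.
    f4_frame_images (u @ f4_coxeter_power 4) = f4_frame_images (f4_coxeter_power 4 @ u)"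
  by code_simp

lemma f4_cyclic_words_closed:
  "\<forall>u\<in>set f4_cyclic_words. \<forall>v\<in>set f4_cyclic_words.
    f4_frame_images (u @ v) \<in> set (map f4_frame_images f4_cyclic_words)"
  by code_simp

lemma f4_cyclic_words_inverse:
  "\<forall>u\<in>set f4_cyclic_words. \<exists>v\<in>set f4_cyclic_words.
    f4_frame_images (v @ u) = f4_frame_images []"
  by code_simp

lemma f4_cyclic_words_distinct: "distinct (map f4_frame_images f4_cyclic_words)"
  by code_simp

lemma f4_cyclic_words_power:
  "\<forall>u\<in>set f4_cyclic_words. f4_frame_images u = f4_frame_images [] \<or>
    f4_frame_images u = f4_frame_images (f4_coxeter_power 4) \<or>
    f4_frame_images (u @ u) = f4_frame_images (f4_coxeter_power 4)"
  by code_simp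

lemma f4_cyclic_words_commute:
  "\<forall>u\<in>set f4_cyclic_words.
    f4_frame_images (u @ f4_coxeter_power 4) = f4_frame_images (f4_coxeter_power 4 @ u)"
  by code_simp

text \<open>
  The commutator of \<open>c\<^sup>4\<close> with \<open>s\<^sub>1 s\<^sub>2\<close> is a right multiplication by a unit of order 4, whose square is \<open>-1\<close>;
  this puts \<open>-1\<close> into the normal closure of \<open>c\<^sup>4\<close>.
\<close>

lemma f4_commutator_square:
  "f4_frame_images (concat (replicate 2 (rev (f4_coxeter_power 4) @ [1, 2] @ f4_coxeter_power 4 @ [2, 1])))
    = f4_frame_images (f4_coxeter_power 6)"
  by code_simp

lemma f4_coxeter_power_6: "F4.act (f4_coxeter_power 6) x = - x"
proof -
  have "F4.act (f4_coxeter_power 6) = F4.act (concat (replicate 2 (f4_coxeter_power 3)))"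
    by (simp add: f4_coxeter_power_def eval_nat_numeral)
  moreover have "F4.act (f4_coxeter_power 3) (F4.act (f4_coxeter_power 3) x) = - x"
    by (cases x) (simp add: f4_coxeter_power_def eval_nat_numeral)
  ultimately show ?thesis by (simp add: eval_nat_numeral)
qed

lemma f4_elem_inverse:
  assumes "u \<in> lists {1..4}"
  shows "inv\<^bsub>W_F4\<^esub> f4_elem u = f4_elem (rev u)"
proof (rule group.inv_equality[OF group_W_F4])
  have r: "rev u \<in> lists {1..4}" "rev u @ u \<in> lists {1..4}" using assms by auto
  then have "f4_elem (rev u @ u) = f4_elem []"
    by (simp only: coxeter_class_eq_iff lists.Nil coxeter_eq_rev_cancel[OF F4.diag assms])
  then show "f4_elem (rev u) \<otimes>\<^bsub>W_F4\<^esub> f4_elem u = \<one>\<^bsub>W_F4\<^esub>"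
    by (simp only: f4_elem_mult[OF r(1) assms] one_W_F4)
qed (use assms in \<open>auto simp only: carrier_W_F4 intro!: imageI\<close>, auto)

lemma f4_elem_subgroup:
  assumes ws: "set ws \<subseteq> lists {1..4}" "ws \<noteq> []"
    and closed: "\<forall>u\<in>set ws. \<forall>v\<in>set ws. f4_frame_images (u @ v) \<in> set (map f4_frame_images ws)"
    and inverse: "\<forall>u\<in>set ws. \<exists>v\<in>set ws. f4_frame_images (v @ u) = f4_frame_images []"
  shows "subgroup (f4_elem ` set ws) W_F4"
proof (rule group.subgroupI[OF group_W_F4])
  show "f4_elem ` set ws \<subseteq> carrier W_F4" using ws(1) by (simp only: carrier_W_F4 image_mono)
  show "f4_elem ` set ws \<noteq> {}" using ws(2) by simp
next
  fix x assume "x \<in> f4_elem ` set ws"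
  then obtain u where u: "u \<in> set ws" "x = f4_elem u" by blast
  obtain v where v: "v \<in> set ws" "f4_frame_images (v @ u) = f4_frame_images []"
    using inverse u(1) by blast
  have l: "u \<in> lists {1..4}" "v \<in> lists {1..4}" using u(1) v(1) ws(1) by blast+
  then have vu: "v @ u \<in> lists {1..4}" by simp
  have "f4_elem (v @ u) = f4_elem []" using v(2) by (simp only: f4_elem_eq_iff[OF vu lists.Nil])
  then have "f4_elem v \<otimes>\<^bsub>W_F4\<^esub> x = \<one>\<^bsub>W_F4\<^esub>"
    by (simp only: u(2) f4_elem_mult[OF l(2,1)] one_W_F4)
  then have "inv\<^bsub>W_F4\<^esub> x = f4_elem v"
    using l u(2) by (intro group.inv_equality[OF group_W_F4]) (auto simp only: carrier_W_F4)
  then show "inv\<^bsub>W_F4\<^esub> x \<in> f4_elem ` set ws" using v(1) by blast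
next
  fix x y assume "x \<in> f4_elem ` set ws" "y \<in> f4_elem ` set ws"
  then obtain u v where uv: "u \<in> set ws" "x = f4_elem u" "v \<in> set ws" "y = f4_elem v" by blast
  obtain w where w: "w \<in> set ws" "f4_frame_images (u @ v) = f4_frame_images w"
    using closed uv(1,3) by fastforce
  have l: "u \<in> lists {1..4}" "v \<in> lists {1..4}" "w \<in> lists {1..4}" using uv w(1) ws(1) by blast+
  then have "u @ v \<in> lists {1..4}" by simp
  then have "f4_elem (u @ v) = f4_elem w" using w(2) l(3) by (simp only: f4_elem_eq_iff)
  then show "x \<otimes>\<^bsub>W_F4\<^esub> y \<in> f4_elem ` set ws"
    unfolding uv(2,4) f4_elem_mult[OF l(1,2)] using w(1) by simp
qed

lemma card_f4_elem:
  assumes "set ws \<subseteq> lists {1..4}" "distinct (map f4_frame_images ws)"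
  shows "card (f4_elem ` set ws) = length ws"
proof -
  have "inj_on f4_elem (set ws)"
  proof (rule inj_onI)
    fix u v assume uv: "u \<in> set ws" "v \<in> set ws" "f4_elem u = f4_elem v"
    then have "u \<in> lists {1..4}" "v \<in> lists {1..4}" using assms(1) by blast+
    then have "f4_frame_images u = f4_frame_images v" using uv(3) by (simp only: f4_elem_eq_iff)
    then show "u = v" using uv(1,2) assms(2) by (simp add: distinct_map inj_on_def)
  qed
  then show ?thesis using assms(2) by (simp add: card_image distinct_map distinct_card)
qed

lemma W_F4_degree_ge:
  assumes f: "f \<in> mon W_F4 (sym_group m)"
  shows "24 \<le> m"
proof -
  let ?z = "f4_elem (f4_coxeter_power 6)" and ?a = "f4_elem (f4_coxeter_power 4)"
  let ?K = "f4_elem ` set f4_quaternion_words" and ?A = "f4_elem ` set f4_cyclic_words"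
  interpret W: group W_F4 by (rule group_W_F4)
  note l = f4_coxeter_power_lists
  have in_carrier: "f4_elem u \<in> carrier W_F4" if "u \<in> lists {1..4}" for u
    unfolding carrier_W_F4 using that by (rule imageI)
  have frame_eq: "f4_elem u = f4_elem v"
    if "f4_frame_images u = f4_frame_images v" "u \<in> lists {1..4}" "v \<in> lists {1..4}" for u v
    using that by (simp only: f4_elem_eq_iff)
  have commutes: "x \<otimes>\<^bsub>W_F4\<^esub> ?a = ?a \<otimes>\<^bsub>W_F4\<^esub> x"
    if prems: "x \<in> f4_elem ` set ws" "set ws \<subseteq> lists {1..4}"
      "\<forall>u\<in>set ws. f4_frame_images (u @ f4_coxeter_power 4) = f4_frame_images (f4_coxeter_power 4 @ u)"
    for x ws
  proof -
    obtain u where u: "u \<in> set ws" "x = f4_elem u" using prems(1) by blast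
    have ul: "u \<in> lists {1..4}" using prems(2) u(1) by blast
    have "f4_elem (u @ f4_coxeter_power 4) = f4_elem (f4_coxeter_power 4 @ u)"
      using prems(3) u(1) ul l by (intro frame_eq) simp_all
    then show ?thesis by (simp only: u(2) f4_elem_mult[OF ul l] f4_elem_mult[OF l ul])
  qed
  have power: "\<exists>n::nat. x [^]\<^bsub>W_F4\<^esub> n = f4_elem v"
    if prems: "x \<in> f4_elem ` set ws" "x \<noteq> \<one>\<^bsub>W_F4\<^esub>" "set ws \<subseteq> lists {1..4}" "v \<in> lists {1..4}"
      "\<forall>u\<in>set ws. f4_frame_images u = f4_frame_images [] \<or> f4_frame_images u = f4_frame_images v \<or>
        f4_frame_images (u @ u) = f4_frame_images v"
    for x ws v
  proof -
    obtain u where u: "u \<in> set ws" "x = f4_elem u" using prems(1) by blast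
    have ul: "u \<in> lists {1..4}" using prems(3) u(1) by blast
    have xc: "x \<in> carrier W_F4" using in_carrier ul u(2) by simp
    have "f4_frame_images u \<noteq> f4_frame_images []"
      using frame_eq[OF _ ul lists.Nil] prems(2) u(2) one_W_F4 by metis
    then consider "f4_frame_images u = f4_frame_images v" | "f4_frame_images (u @ u) = f4_frame_images v"
      using prems(5) u(1) by blast
    then show ?thesis
    proof cases
      case 1
      then have "x [^]\<^bsub>W_F4\<^esub> (1::nat) = f4_elem v"
        using frame_eq[OF 1 ul prems(4)] xc u(2) by simp
      then show ?thesis ..
    next
      case 2
      have "u @ u \<in> lists {1..4}" using ul by simp
      then have "x \<otimes>\<^bsub>W_F4\<^esub> x = f4_elem v"
        using frame_eq[OF 2 _ prems(4)] by (simp only: u(2) f4_elem_mult[OF ul ul])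
      then have "x [^]\<^bsub>W_F4\<^esub> (2::nat) = f4_elem v"
        using xc by (simp add: numeral_2_eq_2)
      then show ?thesis ..
    qed
  qed
  have card_K: "card ?K = 8"
    unfolding card_f4_elem[OF f4_words_lists(1) f4_quaternion_words_distinct]
    by (simp add: f4_quaternion_words_def Let_def)
  have card_A: "card ?A = 3"
    unfolding card_f4_elem[OF f4_words_lists(2) f4_cyclic_words_distinct]
    by (simp add: f4_cyclic_words_def)
  have "card ?A * card ?K \<le> m"
  proof (rule card_mult_card_le_degree[OF group_W_F4 f])
    show "?z \<in> carrier W_F4" "?a \<in> carrier W_F4" using in_carrier l by blast+
    have "F4.act (f4_coxeter_power 6) (1, 0, 0, 0) \<noteq> F4.act [] (1, 0, 0, 0)"
      by (simp add: f4_coxeter_power_6)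
    then have "F4.act (f4_coxeter_power 6) \<noteq> F4.act []" by metis
    then show "?z \<noteq> \<one>\<^bsub>W_F4\<^esub>" by (simp only: one_W_F4 f4_elem_eq_iff_act[OF l lists.Nil] not_False_eq_True)
  next
    fix g assume "g \<in> carrier W_F4"
    then obtain u where u: "u \<in> lists {1..4}" "g = f4_elem u" unfolding carrier_W_F4 by blast
    have uz: "u @ f4_coxeter_power 6 \<in> lists {1..4}" "f4_coxeter_power 6 @ u \<in> lists {1..4}"
      using u(1) l by simp_all
    have "F4.act (u @ f4_coxeter_power 6) = F4.act (f4_coxeter_power 6 @ u)"
      by (simp add: fun_eq_iff f4_coxeter_power_6 F4.act_minus)
    then show "g \<otimes>\<^bsub>W_F4\<^esub> ?z = ?z \<otimes>\<^bsub>W_F4\<^esub> g"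
      by (simp only: u(2) f4_elem_mult[OF u(1) l] f4_elem_mult[OF l u(1)] f4_elem_eq_iff_act[OF uz])
  next
    \<comment> \<open>A normal subgroup containing \<open>c\<^sup>4\<close> contains its commutator \<open>w\<close> with \<open>s\<^sub>1 s\<^sub>2\<close>, and \<open>w\<close> squares to \<open>z\<close>.\<close>
    fix L assume L: "L \<lhd> W_F4" and a: "?a \<in> L"
    have sub: "subgroup L W_F4" using L by (rule normal_imp_subgroup)
    let ?t = "[1, 2] :: nat list"
    have t: "?t \<in> lists {1..4}" "[2, 1] \<in> lists {1..4::nat}" by simp_all
    have l': "rev (f4_coxeter_power 4) \<in> lists {1..4}" using l[of 4] by auto
    have ta': "?t @ f4_coxeter_power 4 \<in> lists {1..4}" using l[of 4] t(1) by simp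
    have conj: "f4_elem ?t \<otimes>\<^bsub>W_F4\<^esub> ?a \<otimes>\<^bsub>W_F4\<^esub> f4_elem [2, 1] \<in> L"
      using normal.inv_op_closed2[OF L in_carrier[OF t(1)] a]
      by (simp only: f4_elem_inverse[OF t(1)] rev.simps append.simps)
    have "f4_elem ?t \<otimes>\<^bsub>W_F4\<^esub> ?a \<otimes>\<^bsub>W_F4\<^esub> f4_elem [2, 1] = f4_elem (?t @ f4_coxeter_power 4 @ [2, 1])"
      by (simp only: f4_elem_mult[OF t(1) l] f4_elem_mult[OF ta' t(2)] append_assoc)
    note conj = conj[unfolded this]
    have inva: "f4_elem (rev (f4_coxeter_power 4)) \<in> L"
      using subgroup.m_inv_closed[OF sub a] by (simp only: f4_elem_inverse[OF l])
    define w where "w = rev (f4_coxeter_power 4) @ ?t @ f4_coxeter_power 4 @ [2, 1]"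
    have ta: "?t @ f4_coxeter_power 4 @ [2, 1] \<in> lists {1..4}" using ta' t(2) by simp
    then have w: "w \<in> lists {1..4}" "w @ w \<in> lists {1..4}" using l' by (simp_all add: w_def)
    have "f4_elem w \<in> L"
      using subgroup.m_closed[OF sub inva conj] by (simp only: f4_elem_mult[OF l' ta] w_def)
    then have "f4_elem (w @ w) \<in> L"
      using subgroup.m_closed[OF sub, of "f4_elem w" "f4_elem w"] by (simp only: f4_elem_mult[OF w(1) w(1)])
    moreover have "f4_elem (w @ w) = ?z"
    proof (rule frame_eq[OF _ w(2) l])
      have "concat (replicate 2 w) = w @ w" by (simp add: numeral_2_eq_2)
      then show "f4_frame_images (w @ w) = f4_frame_images (f4_coxeter_power 6)"
        using f4_commutator_square unfolding w_def by (simp only:)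
    qed
    ultimately show "?z \<in> L" by simp
  next
    show "subgroup ?K W_F4"
      by (rule f4_elem_subgroup[OF f4_words_lists(1) _ f4_quaternion_words_closed f4_quaternion_words_inverse])
        (simp add: f4_quaternion_words_def Let_def)
    show "subgroup ?A W_F4"
      by (rule f4_elem_subgroup[OF f4_words_lists(2) _ f4_cyclic_words_closed f4_cyclic_words_inverse])
        (simp add: f4_cyclic_words_def)
    show "k \<otimes>\<^bsub>W_F4\<^esub> ?a = ?a \<otimes>\<^bsub>W_F4\<^esub> k" if "k \<in> ?K" for k
      by (rule commutes[OF that f4_words_lists(1) f4_quaternion_words_commute])
    show "b \<otimes>\<^bsub>W_F4\<^esub> ?a = ?a \<otimes>\<^bsub>W_F4\<^esub> b" if "b \<in> ?A" for b
      by (rule commutes[OF that f4_words_lists(2) f4_cyclic_words_commute])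
    show "\<exists>n::nat. k [^]\<^bsub>W_F4\<^esub> n = ?z" if "k \<in> ?K" "k \<noteq> \<one>\<^bsub>W_F4\<^esub>" for k
      by (rule power[OF that f4_words_lists(1) l f4_quaternion_words_power])
    show "\<exists>n::nat. b [^]\<^bsub>W_F4\<^esub> n = ?a" if "b \<in> ?A" "b \<noteq> \<one>\<^bsub>W_F4\<^esub>" for b
      by (rule power[OF that f4_words_lists(2) l f4_cyclic_words_power])
    have "coprime 3 (8::nat)" by (simp add: coprime_iff_gcd_eq_1 gcd_non_0_nat)
    then show "coprime (card ?A) (card ?K)" by (simp only: card_A card_K)
  qed
  then show ?thesis unfolding card_A card_K by simp
qed

theorem proposition4p17:
  shows "min_perm_degree W_F4 = 24"
  unfolding min_perm_degree_def
proof (rule Least_equality)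
  show "mon W_F4 (sym_group 24) \<noteq> {}" by (rule W_F4_embeds)
next
  fix m assume "mon W_F4 (sym_group m) \<noteq> {}"
  then show "24 \<le> m" using W_F4_degree_ge by blast
qed

end
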